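(* Let $A=\tfrac14$, let $f(m)=\sum_{n=0}^\infty\big(\tfrac{A^n}{n!}\big)^2(-1)^nm^n$, and define on $\mathbb{R}^2$ $$\chi(R,u)=e^{R/2}\,\mathbf{1}_{R^2-u^2\ge0}\,f(u^2-R^2)=e^{R/2}\,\mathbf{1}_{R^2-u^2\ge 0}\sum_{n=0}^\infty\Big(\frac{A^n}{n!}\Big)^2(R^2-u^2)^n .$$ Then $\chi$ is a fundamental solution in $\mathcal{D}'(\mathbb{R}^2)$ of the entropy equation $\mathbf{L}(\eta):=\eta_{RR}-\eta_{uu}-\eta_R=0$; more precisely, $$\mathbf{L}(\chi)=4\,\delta_{(R,u)=(0,0)}\quad\text{in }\mathcal{D}'(\mathbb{R}^2).$$
   Context: $\mathbf{1}_{g\ge0}$ is the characteristic function of $\{g\ge0\}$; $\delta_{(R,u)=(0,0)}$ is the Dirac mass at the origin of $\mathbb{R}^2$; derivatives are in the sense of distributions. *)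

theory Defs
  imports "HOL-Analysis.Analysis"
begin

abbreviation dir_deriv ::
  "'a::real_normed_vector \<Rightarrow> ('a \<Rightarrow> 'b::real_normed_vector) \<Rightarrow> 'a \<Rightarrow> 'b"
  where "dir_deriv v f \<equiv> (\<lambda>x. frechet_derivative f (at x) v)"

primrec C_k :: "nat \<Rightarrow> ('a::real_normed_vector \<Rightarrow> 'b::real_normed_vector) \<Rightarrow> bool"
  where
    "C_k 0 f \<longleftrightarrow> continuous_on UNIV f"
  | "C_k (Suc k) f \<longleftrightarrow> (\<forall>x. f differentiable (at x)) \<and> (\<forall>v. C_k k (dir_deriv v f))"

definition smooth :: "('a::real_normed_vector \<Rightarrow> 'b::real_normed_vector) \<Rightarrow> bool"
  where "smooth f \<longleftrightarrow> (\<forall>k. C_k k f)"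

definition supp :: "('a::topological_space \<Rightarrow> real) \<Rightarrow> 'a set"
  where "supp \<phi> = closure {x. \<phi> x \<noteq> 0}"

definition test_functions :: "('a::euclidean_space \<Rightarrow> real) set"
  where "test_functions = {\<phi>. smooth \<phi> \<and> compact (supp \<phi>)}"

text \<open>
  A distribution is represented by a functional on all functions of which only the restriction to
  \<^const>\<open>test_functions\<close> matters. So two distributions are equal if they agree on
  \<^const>\<open>test_functions\<close>. Continuity is the usual seminorm estimate on each compact set;
  mixed partial derivatives are indexed by lists of basis vectors instead of multi-indices.
\<close>

definition distribution :: "(('a::euclidean_space \<Rightarrow> real) \<Rightarrow> real) \<Rightarrow> bool"
  where "distribution T \<longleftrightarrow>
    (\<forall>\<phi>\<in>test_functions. \<forall>\<psi>\<in>test_functions. T (\<lambda>x. \<phi> x + \<psi> x) = T \<phi> + T \<psi>) \<and>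
    (\<forall>\<phi>\<in>test_functions. \<forall>c. T (\<lambda>x. c * \<phi> x) = c * T \<phi>) \<and>
    (\<forall>K. compact K \<longrightarrow> (\<exists>C N. \<forall>\<phi>\<in>test_functions. supp \<phi> \<subseteq> K \<longrightarrow>
       \<bar>T \<phi>\<bar> \<le> C * (\<Sum>vs | set vs \<subseteq> Basis \<and> length vs \<le> N. SUP x. \<bar>foldr dir_deriv vs \<phi> x\<bar>)))"

definition distr_eq ::
  "(('a::euclidean_space \<Rightarrow> real) \<Rightarrow> real) \<Rightarrow> (('a \<Rightarrow> real) \<Rightarrow> real) \<Rightarrow> bool"
  where "distr_eq S T \<longleftrightarrow> (\<forall>\<phi>\<in>test_functions. S \<phi> = T \<phi>)"

definition locally_integrable :: "('a::euclidean_space \<Rightarrow> real) \<Rightarrow> bool"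
  where "locally_integrable g \<longleftrightarrow> (\<forall>K. compact K \<longrightarrow> g absolutely_integrable_on K)"

definition regular_distr :: "('a::euclidean_space \<Rightarrow> real) \<Rightarrow> ('a \<Rightarrow> real) \<Rightarrow> real"
  where "regular_distr g \<phi> = (LINT x|lebesgue. g x * \<phi> x)"

definition dirac :: "'a \<Rightarrow> ('a \<Rightarrow> real) \<Rightarrow> real"
  where "dirac a \<phi> = \<phi> a"

definition distr_deriv ::
  "'a::euclidean_space \<Rightarrow> (('a \<Rightarrow> real) \<Rightarrow> real) \<Rightarrow> ('a \<Rightarrow> real) \<Rightarrow> real"
  where "distr_deriv v T \<phi> = - T (dir_deriv v \<phi>)"

text \<open>Points of the plane are pairs \<open>(R, u)\<close>.\<close>

abbreviation D_R :: "((real \<times> real \<Rightarrow> real) \<Rightarrow> real) \<Rightarrow> (real \<times> real \<Rightarrow> real) \<Rightarrow> real"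
  where "D_R \<equiv> distr_deriv (1, 0)"

abbreviation D_u :: "((real \<times> real \<Rightarrow> real) \<Rightarrow> real) \<Rightarrow> (real \<times> real \<Rightarrow> real) \<Rightarrow> real"
  where "D_u \<equiv> distr_deriv (0, 1)"

definition entropy_op ::
  "((real \<times> real \<Rightarrow> real) \<Rightarrow> real) \<Rightarrow> (real \<times> real \<Rightarrow> real) \<Rightarrow> real"
  where "entropy_op \<eta> \<phi> = D_R (D_R \<eta>) \<phi> - D_u (D_u \<eta>) \<phi> - D_R \<eta> \<phi>"

end

theory Submission
  imports Defs
begin

text \<open>
  In light-cone coordinates \<open>p = R + u\<close>, \<open>q = R - u\<close> the support of \<open>\<chi>\<close> is the union of the
  quadrants where \<open>p q \<ge> 0\<close> and \<open>\<chi> = exp (R / 2) F (p q)\<close>, where \<open>s F'' + F' = F / 16\<close> and \<open>F 0 = 1\<close>.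
  With \<open>\<psi> = exp (R / 2) \<phi>\<close> the adjoint operator becomes
  \<open>exp (R / 2) (\<phi>\<^sub>R\<^sub>R - \<phi>\<^sub>u\<^sub>u + \<phi>\<^sub>R) = 4 (\<psi>\<^sub>p\<^sub>q - \<psi> / 16)\<close>, and the equation for \<open>F\<close> gives
  \<open>F (p q) (\<psi>\<^sub>p\<^sub>q - \<psi> / 16) = \<partial>\<^sub>p (F (p q) \<psi>\<^sub>q) - \<partial>\<^sub>q (q F' (p q) \<psi>)\<close>.
  Over the first quadrant the second term integrates to zero and the first one to
  \<open>- \<integral> \<psi>\<^sub>q (0, q) dq = \<psi> (0, 0)\<close>; the third quadrant follows by reflection. With the Jacobian
  \<open>1 / 2\<close> the total is \<open>4 / 2 * 2 \<phi> (0, 0) = 4 \<phi> (0, 0)\<close>.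
\<close>

subsection \<open>Directional derivatives of smooth functions\<close>

lemma smooth_imp_continuous: "smooth f \<Longrightarrow> continuous_on UNIV f"
  by (metis C_k.simps(1) smooth_def)

lemma smooth_imp_differentiable: "smooth f \<Longrightarrow> f differentiable (at x)"
  by (metis C_k.simps(2) smooth_def)

lemma smooth_dir_deriv: "smooth f \<Longrightarrow> smooth (dir_deriv v f)"
  by (metis C_k.simps(2) smooth_def)

text \<open>Chain rule along a curve. It serves both the mean value arguments on segments and
  differentiation along light-cone coordinate lines.\<close>

lemma smooth_has_real_derivative:
  fixes f :: "'a::real_normed_vector \<Rightarrow> real"
  assumes "smooth f" "(\<gamma> has_vector_derivative v) (at t within S)"
  shows "((\<lambda>s. f (\<gamma> s)) has_real_derivative dir_deriv v f (\<gamma> t)) (at t within S)"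
proof -
  have "(f has_derivative frechet_derivative f (at (\<gamma> t))) (at (\<gamma> t))"
    using smooth_imp_differentiable[OF assms(1)] frechet_derivative_works by blast
  from vector_derivative_diff_chain_within[OF assms(2) has_derivative_at_withinI[OF this]]
  show ?thesis
    by (simp add: has_real_derivative_iff_has_vector_derivative o_def)
qed

lemma smooth_dir_deriv_lin:
  fixes f :: "'a::real_normed_vector \<Rightarrow> real"
  assumes "smooth f"
  shows "dir_deriv (a *\<^sub>R v + b *\<^sub>R w) f = (\<lambda>x. a * dir_deriv v f x + b * dir_deriv w f x)"
  using linear_frechet_derivative[OF smooth_imp_differentiable[OF assms]]
  by (simp add: linear_add linear_scale)

text \<open>The mean value theorem is applied twice: first in direction \<open>v\<close> to the
  \<open>w\<close>-increment of \<open>f\<close>, then in direction \<open>w\<close> to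
  \<open>dir_deriv v f\<close>. The double difference is symmetric in \<open>v\<close> and
  \<open>w\<close>, which is the source of the symmetry of second derivatives.\<close>

lemma double_difference_mvt:
  fixes f :: "'a::real_normed_vector \<Rightarrow> real"
  assumes "smooth f" "h > 0"
  obtains \<sigma> \<tau> where "0 < \<sigma>" "\<sigma> < h" "0 < \<tau>" "\<tau> < h"
    "f (x + h *\<^sub>R v + h *\<^sub>R w) - f (x + h *\<^sub>R v) - f (x + h *\<^sub>R w) + f x
      = h * h * dir_deriv w (dir_deriv v f) (x + \<sigma> *\<^sub>R v + \<tau> *\<^sub>R w)"
proof -
  let ?fv = "dir_deriv v f"
  have "((\<lambda>s. f (x + s *\<^sub>R v + h *\<^sub>R w) - f (x + s *\<^sub>R v)) has_real_derivative
      ?fv (x + s *\<^sub>R v + h *\<^sub>R w) - ?fv (x + s *\<^sub>R v)) (at s)" for s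
    by (intro DERIV_diff smooth_has_real_derivative[OF assms(1)])
      (auto intro!: derivative_eq_intros simp: has_vector_derivative_def)
  from MVT2[OF assms(2) this] obtain \<sigma> where \<sigma>: "0 < \<sigma>" "\<sigma> < h"
    "f (x + h *\<^sub>R v + h *\<^sub>R w) - f (x + h *\<^sub>R v) - (f (x + h *\<^sub>R w) - f x)
      = h * (?fv (x + \<sigma> *\<^sub>R v + h *\<^sub>R w) - ?fv (x + \<sigma> *\<^sub>R v))"
    by auto
  have "((\<lambda>t. ?fv (x + \<sigma> *\<^sub>R v + t *\<^sub>R w)) has_real_derivative
      dir_deriv w ?fv (x + \<sigma> *\<^sub>R v + t *\<^sub>R w)) (at t)" for t
    by (intro smooth_has_real_derivative smooth_dir_deriv[OF assms(1)])
      (auto intro!: derivative_eq_intros simp: has_vector_derivative_def)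
  from MVT2[OF assms(2) this] obtain \<tau> where \<tau>: "0 < \<tau>" "\<tau> < h"
    "?fv (x + \<sigma> *\<^sub>R v + h *\<^sub>R w) - ?fv (x + \<sigma> *\<^sub>R v)
      = h * dir_deriv w ?fv (x + \<sigma> *\<^sub>R v + \<tau> *\<^sub>R w)"
    by auto
  show ?thesis
    using that[of \<sigma> \<tau>] \<sigma> \<tau> by (simp add: algebra_simps)
qed

text \<open>Schwarz's theorem. The same double difference is evaluated in both orders,
  \<open>h n * h n\<close> is cancelled, and continuity of the second derivatives gives the
  limit.\<close>

lemma dir_deriv_commute:
  fixes f :: "'a::real_normed_vector \<Rightarrow> real"
  assumes "smooth f"
  shows "dir_deriv w (dir_deriv v f) x = dir_deriv v (dir_deriv w f) x"
proof -
  define h :: "nat \<Rightarrow> real" where "h n = 1 / Suc n" for n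
  have h: "h n > 0" for n by (simp add: h_def)
  have h0: "h \<longlonglongrightarrow> 0"
    unfolding h_def using LIMSEQ_Suc[OF lim_1_over_n] by simp
  have "\<exists>\<sigma> \<tau> \<sigma>' \<tau>'. 0 < \<sigma> \<and> \<sigma> < h n \<and> 0 < \<tau> \<and> \<tau> < h n \<and> 0 < \<sigma>' \<and> \<sigma>' < h n \<and> 0 < \<tau>' \<and> \<tau>' < h n \<and>
     dir_deriv w (dir_deriv v f) (x + \<sigma> *\<^sub>R v + \<tau> *\<^sub>R w) =
     dir_deriv v (dir_deriv w f) (x + \<sigma>' *\<^sub>R w + \<tau>' *\<^sub>R v)" for n
  proof -
    from double_difference_mvt[OF assms h[of n], of x v w] obtain \<sigma> \<tau> where
      1: "0 < \<sigma>" "\<sigma> < h n" "0 < \<tau>" "\<tau> < h n"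
        "f (x + h n *\<^sub>R v + h n *\<^sub>R w) - f (x + h n *\<^sub>R v) - f (x + h n *\<^sub>R w) + f x
          = h n * h n * dir_deriv w (dir_deriv v f) (x + \<sigma> *\<^sub>R v + \<tau> *\<^sub>R w)" .
    from double_difference_mvt[OF assms h[of n], of x w v] obtain \<sigma>' \<tau>' where
      2: "0 < \<sigma>'" "\<sigma>' < h n" "0 < \<tau>'" "\<tau>' < h n"
        "f (x + h n *\<^sub>R w + h n *\<^sub>R v) - f (x + h n *\<^sub>R w) - f (x + h n *\<^sub>R v) + f x
          = h n * h n * dir_deriv v (dir_deriv w f) (x + \<sigma>' *\<^sub>R w + \<tau>' *\<^sub>R v)" .
    have "h n * h n * dir_deriv w (dir_deriv v f) (x + \<sigma> *\<^sub>R v + \<tau> *\<^sub>R w) =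
      h n * h n * dir_deriv v (dir_deriv w f) (x + \<sigma>' *\<^sub>R w + \<tau>' *\<^sub>R v)"
      unfolding 1(5)[symmetric] 2(5)[symmetric] by (simp add: add_ac)
    then show ?thesis
      using 1 2 h[of n] by (intro exI[of _ \<sigma>] exI[of _ \<tau>] exI[of _ \<sigma>'] exI[of _ \<tau>']) simp
  qed
  then obtain \<sigma> \<tau> \<sigma>' \<tau>' where
    b: "\<And>n. 0 < \<sigma> n" "\<And>n. \<sigma> n < h n" "\<And>n. 0 < \<tau> n" "\<And>n. \<tau> n < h n"
       "\<And>n. 0 < \<sigma>' n" "\<And>n. \<sigma>' n < h n" "\<And>n. 0 < \<tau>' n" "\<And>n. \<tau>' n < h n"
    and eq: "\<And>n. dir_deriv w (dir_deriv v f) (x + \<sigma> n *\<^sub>R v + \<tau> n *\<^sub>R w) =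
     dir_deriv v (dir_deriv w f) (x + \<sigma>' n *\<^sub>R w + \<tau>' n *\<^sub>R v)"
    by metis
  \<comment> \<open>All four families of intermediate parameters lie between \<open>0\<close> and
    \<open>h n\<close>, so both evaluation points tend to \<open>x\<close>.\<close>
  have sq: "k \<longlonglongrightarrow> 0" if "\<And>n. 0 < k n" "\<And>n. k n < h n" for k :: "nat \<Rightarrow> real"
    by (rule tendsto_sandwich[OF _ _ tendsto_const h0]) (auto intro!: always_eventually less_imp_le that)
  have c: "isCont (dir_deriv w (dir_deriv v f)) x" "isCont (dir_deriv v (dir_deriv w f)) x"
    using smooth_imp_continuous[OF smooth_dir_deriv[OF smooth_dir_deriv[OF assms]]]
    by (simp_all add: continuous_on_eq_continuous_at)
  have "(\<lambda>n. x + \<sigma> n *\<^sub>R v + \<tau> n *\<^sub>R w) \<longlonglongrightarrow> x + 0 *\<^sub>R v + 0 *\<^sub>R w"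
    by (intro tendsto_intros sq b)
  then have "(\<lambda>n. dir_deriv w (dir_deriv v f) (x + \<sigma> n *\<^sub>R v + \<tau> n *\<^sub>R w))
      \<longlonglongrightarrow> dir_deriv w (dir_deriv v f) x"
    by (intro isCont_tendsto_compose[OF c(1)]) simp
  moreover have "(\<lambda>n. x + \<sigma>' n *\<^sub>R w + \<tau>' n *\<^sub>R v) \<longlonglongrightarrow> x + 0 *\<^sub>R w + 0 *\<^sub>R v"
    by (intro tendsto_intros sq b)
  then have "(\<lambda>n. dir_deriv v (dir_deriv w f) (x + \<sigma>' n *\<^sub>R w + \<tau>' n *\<^sub>R v))
      \<longlonglongrightarrow> dir_deriv v (dir_deriv w f) x"
    by (intro isCont_tendsto_compose[OF c(2)]) simp
  ultimately show ?thesis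
    unfolding eq using LIMSEQ_unique by blast
qed

section \<open>Supports, and stability of test functions under differentiation\<close>

lemma eq_0_outside_supp: "x \<notin> supp f \<Longrightarrow> f x = 0"
  using closure_subset[of "{x. f x \<noteq> 0}"] by (auto simp: supp_def)

text \<open>The complement of the closed support is open, so \<open>f\<close> is identically zero
  near \<open>x\<close>; no differentiability assumption on \<open>f\<close> is made.\<close>

lemma dir_deriv_eq_0_outside_supp:
  assumes "x \<notin> supp f"
  shows "dir_deriv v f x = 0"
proof -
  have "open (- supp f)" unfolding supp_def by (intro open_Compl closed_closure)
  then have "(f has_derivative (\<lambda>_. 0)) (at x)"
    using has_derivative_transform_within_open[OF has_derivative_const, of "- supp f" x 0 f UNIV]
      assms eq_0_outside_supp[of _ f]
    by auto
  then show ?thesis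
    using frechet_derivative_at by metis
qed

lemma supp_dir_deriv: "supp (dir_deriv v f) \<subseteq> supp f"
proof -
  have "{x. dir_deriv v f x \<noteq> 0} \<subseteq> supp f"
    using dir_deriv_eq_0_outside_supp by blast
  then show ?thesis
    unfolding supp_def by (simp add: closure_minimal)
qed

lemma test_function_dir_deriv:
  assumes "\<phi> \<in> test_functions"
  shows "dir_deriv v \<phi> \<in> test_functions"
proof -
  have "closed (supp (dir_deriv v \<phi>))" by (simp add: supp_def)
  then have "compact (supp \<phi> \<inter> supp (dir_deriv v \<phi>))"
    using assms by (auto simp: test_functions_def intro: compact_Int_closed)
  then show ?thesis
    using assms supp_dir_deriv[of \<phi> v]
    by (auto simp: test_functions_def Int_absorb1 intro: smooth_dir_deriv)
qed

subsection \<open>The power series\<close>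

text \<open>For \<open>s \<ge> 0\<close> the sum is the modified Bessel function \<open>I\<^sub>0 (2 a \<surd>s)\<close>.\<close>

definition bessel :: "real \<Rightarrow> real \<Rightarrow> real"
  where "bessel a s = (\<Sum>n. (a ^ n / fact n)\<^sup>2 * s ^ n)"

text \<open>Bounding one of the two factors \<open>1 / fact n\<close> by \<open>1\<close> leaves the
  exponential series at \<open>a\<^sup>2 * \<bar>s\<bar>\<close> as a majorant.\<close>

lemma summable_bessel: "summable (\<lambda>n. (a ^ n / fact n)\<^sup>2 * s ^ n :: real)"
proof (rule summable_comparison_test'[where N = 0])
  show "summable (\<lambda>n. inverse (fact n) * (a\<^sup>2 * \<bar>s\<bar>) ^ n)" by (rule summable_exp)
  fix n :: nat
  have "norm ((a ^ n / fact n)\<^sup>2 * s ^ n) = inverse (fact n) * (inverse (fact n) * (a\<^sup>2 * \<bar>s\<bar>) ^ n)"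
    by (simp add: abs_mult power_abs power_mult_distrib power_divide power2_eq_square divide_inverse
        flip: abs_mult_self_eq[of "a ^ n"])
  also have "\<dots> \<le> 1 * (inverse (fact n) * (a\<^sup>2 * \<bar>s\<bar>) ^ n)"
    by (intro mult_right_mono) (auto simp: field_simps)
  finally show "norm ((a ^ n / fact n)\<^sup>2 * s ^ n) \<le> inverse (fact n) * (a\<^sup>2 * \<bar>s\<bar>) ^ n" by simp
qed

lemma bessel_0: "bessel a 0 = 1"
  unfolding bessel_def powser_zero by simp

text \<open>The differential equation is the coefficient recursion
  \<open>(n + 1)\<^sup>2 * c (n + 1) = a\<^sup>2 * c n\<close>, since
  \<open>diffs c n = (n + 1) * c (n + 1)\<close>. Continuity of \<open>F2\<close> is what later
  makes the integrands continuous.\<close>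

lemma bessel_ode:
  obtains F1 F2 where
    "\<And>s. (bessel a has_real_derivative F1 s) (at s)"
    "\<And>s. (F1 has_real_derivative F2 s) (at s)"
    "\<And>s. s * F2 s + F1 s = a\<^sup>2 * bessel a s"
    "continuous_on UNIV F2"
proof -
  define c :: "nat \<Rightarrow> real" where "c n = (a ^ n / fact n)\<^sup>2" for n
  have s0: "summable (\<lambda>n. c n * s ^ n)" for s
    using summable_bessel by (simp add: c_def)
  have s1: "summable (\<lambda>n. diffs c n * s ^ n)" for s
    using termdiff_converges_all[OF s0] .
  have s2: "summable (\<lambda>n. diffs (diffs c) n * s ^ n)" for s
    using termdiff_converges_all[OF s1] .
  have s3: "summable (\<lambda>n. diffs (diffs (diffs c)) n * s ^ n)" for s
    using termdiff_converges_all[OF s2] .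
  have b: "bessel a s = (\<Sum>n. c n * s ^ n)" for s by (simp add: bessel_def c_def)
  have c_rec: "real n * diffs c n + diffs c n = a\<^sup>2 * c n" for n
    unfolding diffs_def c_def by (simp add: divide_simps power2_eq_square) (simp add: algebra_simps)
  show ?thesis
  proof (rule that)
    show "(bessel a has_real_derivative (\<Sum>n. diffs c n * s ^ n)) (at s)" for s
      using termdiffs_strong_converges_everywhere[OF s0] by (simp add: b[abs_def])
    show "((\<lambda>s. \<Sum>n. diffs c n * s ^ n) has_real_derivative (\<Sum>n. diffs (diffs c) n * s ^ n)) (at s)" for s
      using termdiffs_strong_converges_everywhere[OF s1] by simp
    show "continuous_on UNIV (\<lambda>s. \<Sum>n. diffs (diffs c) n * s ^ n)"
      using DERIV_isCont[OF termdiffs_strong_converges_everywhere[OF s2]]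
      by (simp add: continuous_on_eq_continuous_at)
    show "s * (\<Sum>n. diffs (diffs c) n * s ^ n) + (\<Sum>n. diffs c n * s ^ n) = a\<^sup>2 * bessel a s" for s
    proof -
      have "(\<lambda>n. s * (of_nat n * diffs c n * s ^ (n - Suc 0))) sums (s * (\<Sum>n. diffs (diffs c) n * s ^ n))"
        by (intro sums_mult diffs_equiv s2)
      \<comment> \<open>The factor \<open>s\<close> restores the power lost in differentiating. At
        \<open>n = 0\<close>, where the subtraction in the exponent truncates, both sides vanish
        because of the factor \<open>n\<close>.\<close>
      also have "(\<lambda>n. s * (of_nat n * diffs c n * s ^ (n - Suc 0))) = (\<lambda>n. real n * diffs c n * s ^ n)"
        by (rule ext, case_tac n) auto
      finally have "(\<lambda>n. real n * diffs c n * s ^ n + diffs c n * s ^ n) sums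
          (s * (\<Sum>n. diffs (diffs c) n * s ^ n) + (\<Sum>n. diffs c n * s ^ n))"
        by (intro sums_add summable_sums s1)
      also have "(\<lambda>n. real n * diffs c n * s ^ n + diffs c n * s ^ n) = (\<lambda>n. a\<^sup>2 * (c n * s ^ n))"
        using c_rec by (simp flip: distrib_right mult.assoc)
      finally show ?thesis
        using sums_unique2[OF _ sums_mult[OF summable_sums[OF s0]]] b by metis
    qed
  qed
qed

lemma continuous_bessel: "continuous_on S (bessel a)"
proof -
  obtain F1 F2 where "\<And>s. (bessel a has_real_derivative F1 s) (at s)"
    using bessel_ode by metis
  then show ?thesis by (meson DERIV_isCont continuous_at_imp_continuous_on)
qed

subsection \<open>Integration in light-cone coordinates\<close>

text \<open>The linear map has determinant \<open>- 1 / 2\<close>, so pushing Lebesgue measure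
  forward doubles it. The proof splits the map into two one-dimensional affine substitutions with an
  exchange of integrals between them.\<close>

lemma distr_lborel_lightcone:
  "distr lborel borel (\<lambda>(p, q). ((p + q) / 2, (p - q) / 2)) = density lborel (\<lambda>_::real \<times> real. 2)"
proof (rule measure_eqI)
  let ?T = "\<lambda>(p, q). ((p + q) / 2, (p - q) / 2) :: real \<times> real"
  have [measurable]: "?T \<in> borel_measurable borel"
    by (intro borel_measurable_continuous_onI) (auto intro!: continuous_intros simp: split_beta)
  fix X assume "X \<in> sets (distr lborel borel ?T)"
  then have X[measurable]: "X \<in> sets borel" by simp
  define g :: "real \<times> real \<Rightarrow> ennreal" where "g = indicator X"
  have g[measurable]: "g \<in> borel_measurable (borel \<Otimes>\<^sub>M borel)"
    unfolding g_def borel_prod using X by measurable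
  have g'[measurable]: "g \<in> borel_measurable borel"
    unfolding g_def using X by measurable
  have "emeasure (distr lborel borel ?T) X = (\<integral>\<^sup>+x. g (?T x) \<partial>lborel)"
    unfolding g_def by (subst nn_integral_indicator[symmetric], simp, subst nn_integral_distr) auto
  also have "\<dots> = (\<integral>\<^sup>+p. \<integral>\<^sup>+q. g ((p + q) / 2, (p - q) / 2) \<partial>lborel \<partial>lborel)"
    by (subst lborel_prod[symmetric], subst lborel.nn_integral_fst[symmetric])
       (auto simp: split_beta, measurable)
  also have "\<dots> = (\<integral>\<^sup>+p. 2 * (\<integral>\<^sup>+u. g (p - u, u) \<partial>lborel) \<partial>lborel)"
  proof (rule nn_integral_cong)
    fix p :: real
    \<comment> \<open>Substituting \<open>q = p - 2 * u\<close> turns the arguments into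
      \<open>p - u\<close> and \<open>u\<close>; the factor \<open>2\<close> is the whole
      Jacobian.\<close>
    show "(\<integral>\<^sup>+q. g ((p + q) / 2, (p - q) / 2) \<partial>lborel) = 2 * (\<integral>\<^sup>+u. g (p - u, u) \<partial>lborel)"
      by (subst nn_integral_real_affine[where c = "-2" and t = p])
        (auto simp: diff_divide_distrib add_divide_distrib)
  qed
  also have "\<dots> = 2 * (\<integral>\<^sup>+p. \<integral>\<^sup>+u. g (p - u, u) \<partial>lborel \<partial>lborel)"
    by (intro nn_integral_cmult) measurable
  also have "(\<integral>\<^sup>+p. \<integral>\<^sup>+u. g (p - u, u) \<partial>lborel \<partial>lborel) = (\<integral>\<^sup>+u. \<integral>\<^sup>+p. g (p - u, u) \<partial>lborel \<partial>lborel)"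
    by (rule lborel_pair.Fubini') measurable
  also have "\<dots> = (\<integral>\<^sup>+u. \<integral>\<^sup>+R. g (R, u) \<partial>lborel \<partial>lborel)"
  proof (rule nn_integral_cong)
    fix u :: real
    \<comment> \<open>The remaining substitution \<open>R = p - u\<close> is a translation for fixed
      \<open>u\<close>.\<close>
    show "(\<integral>\<^sup>+p. g (p - u, u) \<partial>lborel) = (\<integral>\<^sup>+R. g (R, u) \<partial>lborel)"
      by (subst (2) nn_integral_real_affine[where c = 1 and t = "- u"]) auto
  qed
  also have "\<dots> = (\<integral>\<^sup>+x. g x \<partial>lborel)"
    by (subst lborel_prod[symmetric], rule lborel_pair.nn_integral_snd) measurable
  also have "2 * \<dots> = emeasure (density lborel (\<lambda>_. 2)) X"
    by (simp add: g_def emeasure_density nn_integral_cmult)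
  finally show "emeasure (distr lborel borel ?T) X = emeasure (density lborel (\<lambda>_. 2)) X" .
qed simp

lemma integral_lightcone:
  fixes g :: "real \<times> real \<Rightarrow> real"
  assumes [measurable]: "g \<in> borel_measurable borel"
  shows "(LINT x|lborel. g x) = (LINT x|lborel. g ((fst x + snd x) / 2, (fst x - snd x) / 2)) / 2"
proof -
  let ?T = "\<lambda>(p, q). ((p + q) / 2, (p - q) / 2) :: real \<times> real"
  have [measurable]: "?T \<in> borel_measurable borel"
    by (intro borel_measurable_continuous_onI) (auto intro!: continuous_intros simp: split_beta)
  have "(LINT x|lborel. g (?T x)) = (LINT x|density lborel (\<lambda>_. ennreal 2). g x)"
    using distr_lborel_lightcone by (subst integral_distr[of ?T lborel borel, symmetric]) auto
  also have "\<dots> = 2 * (LINT x|lborel. g x)"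
    by (subst integral_density) auto
  finally show ?thesis by (simp add: split_beta)
qed

section \<open>The adjoint operator integrated over the quadrants\<close>

text \<open>The integrand is a difference of a \<open>p\<close>-derivative and a
  \<open>q\<close>-derivative, so only boundary terms survive. In the application \<open>M\<close>
  lies beyond the support, and the square replaces the whole quadrant.\<close>

lemma quadrant_integral:
  fixes F F1 F2 :: "real \<Rightarrow> real" and \<psi> \<psi>q \<psi>pq :: "real \<times> real \<Rightarrow> real"
  assumes F: "\<And>s. (F has_real_derivative F1 s) (at s)" "\<And>s. (F1 has_real_derivative F2 s) (at s)"
    and ode: "\<And>s. s * F2 s + F1 s = k * F s"
    and F2: "continuous_on UNIV F2"
    and \<psi>: "\<And>p q. ((\<lambda>q. \<psi> (p, q)) has_real_derivative \<psi>q (p, q)) (at q)"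
      "\<And>p q. ((\<lambda>p. \<psi>q (p, q)) has_real_derivative \<psi>pq (p, q)) (at p)"
    and cont: "continuous_on UNIV \<psi>" "continuous_on UNIV \<psi>q" "continuous_on UNIV \<psi>pq"
    and M: "M > 0" "\<And>p. 0 \<le> p \<Longrightarrow> \<psi> (p, M) = 0" "\<And>q. 0 \<le> q \<Longrightarrow> \<psi>q (M, q) = 0"
  shows "integral (cbox (0, 0) (M, M)) (\<lambda>(p, q). F (p * q) * (\<psi>pq (p, q) - k * \<psi> (p, q))) = F 0 * \<psi> (0, 0)"
proof -
  have cF: "continuous_on S F" "continuous_on S F1" for S
    using F by (meson DERIV_isCont continuous_at_imp_continuous_on)+
  \<comment> \<open>\<open>a\<close> is the expanded \<open>p\<close>-derivative of
    \<open>F (p * q) * \<psi>q (p, q)\<close>, and \<open>b\<close> the expanded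
    \<open>q\<close>-derivative of \<open>q * F1 (p * q) * \<psi> (p, q)\<close>. In
    \<open>a - b\<close> the terms with \<open>F1 * \<psi>q\<close> cancel, and \<open>ode\<close>
    turns the rest of \<open>b\<close> into \<open>k * F * \<psi>\<close>.\<close>
  define a where "a = (\<lambda>(p, q). F (p * q) * \<psi>pq (p, q) + q * F1 (p * q) * \<psi>q (p, q))"
  define b where "b = (\<lambda>(p, q). q * F1 (p * q) * \<psi>q (p, q) + (F1 (p * q) + p * q * F2 (p * q)) * \<psi> (p, q))"
  note [continuous_intros] = continuous_on_compose2[OF cF(1)[of UNIV]] continuous_on_compose2[OF cF(2)[of UNIV]]
    continuous_on_compose2[OF F2] continuous_on_compose2[OF cont(1)] continuous_on_compose2[OF cont(2)]
    continuous_on_compose2[OF cont(3)]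
  have ca: "continuous_on S a" and cb: "continuous_on S b" for S
    unfolding a_def b_def split_beta by (intro continuous_intros; auto)+
  have "(\<lambda>(p, q). F (p * q) * (\<psi>pq (p, q) - k * \<psi> (p, q))) = (\<lambda>x. a x - b x)"
  proof (intro ext, safe)
    fix p q
    have "F (p * q) * (\<psi>pq (p, q) - k * \<psi> (p, q)) = F (p * q) * \<psi>pq (p, q) - (k * F (p * q)) * \<psi> (p, q)"
      by (simp add: algebra_simps)
    then show "F (p * q) * (\<psi>pq (p, q) - k * \<psi> (p, q)) = a (p, q) - b (p, q)"
      unfolding a_def b_def ode[symmetric] by (simp add: algebra_simps)
  qed
  then have "integral (cbox (0, 0) (M, M)) (\<lambda>(p, q). F (p * q) * (\<psi>pq (p, q) - k * \<psi> (p, q)))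
      = integral (cbox (0, 0) (M, M)) a - integral (cbox (0, 0) (M, M)) b"
    by (simp add: Henstock_Kurzweil_Integration.integral_diff integrable_continuous ca cb)
  \<comment> \<open>Since \<open>a\<close> is a \<open>p\<close>-derivative, \<open>p\<close> has to
    become the inner variable; for \<open>b\<close> the given order is already right.\<close>
  also have "integral (cbox (0, 0) (M, M)) a = integral (cbox 0 M) (\<lambda>q. integral (cbox 0 M) (\<lambda>p. a (p, q)))"
    unfolding integral_prod_continuous[OF ca]
    by (rule integral_swap_continuous) (simp add: ca split_beta)
  also have "\<dots> = integral (cbox 0 M) (\<lambda>q. - F 0 * \<psi>q (0, q))"
  proof (rule Henstock_Kurzweil_Integration.integral_cong)
    fix q assume q: "q \<in> cbox 0 M"
    have "((\<lambda>p. a (p, q)) has_integral F (M * q) * \<psi>q (M, q) - F (0 * q) * \<psi>q (0, q)) {0..M}"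
      unfolding a_def using M(1)
      by (intro fundamental_theorem_of_calculus)
        (auto simp: has_real_derivative_iff_has_vector_derivative[symmetric]
          intro!: derivative_eq_intros DERIV_chain'[OF _ F(1)] \<psi> DERIV_subset[OF \<psi>(2)])
    then show "integral (cbox 0 M) (\<lambda>p. a (p, q)) = - F 0 * \<psi>q (0, q)"
      using q M(3)[of q] by (simp add: integral_unique)
  qed
  also have "\<dots> = F 0 * \<psi> (0, 0)"
  proof -
    have "((\<lambda>q. - F 0 * \<psi>q (0, q)) has_integral - F 0 * \<psi> (0, M) - - F 0 * \<psi> (0, 0)) {0..M}"
      using M(1)
      by (intro fundamental_theorem_of_calculus)
        (auto simp: has_real_derivative_iff_has_vector_derivative[symmetric]
          intro!: derivative_eq_intros DERIV_subset[OF \<psi>(1)])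
    then show ?thesis using M(2)[of 0] M(1) by (auto dest!: integral_unique)
  qed
  also have "integral (cbox (0, 0) (M, M)) b = integral (cbox 0 M) (\<lambda>p. integral (cbox 0 M) (\<lambda>q. b (p, q)))"
    by (rule integral_prod_continuous[OF cb])
  also have "\<dots> = integral (cbox 0 M) (\<lambda>p. 0)"
  proof (rule Henstock_Kurzweil_Integration.integral_cong)
    fix p assume p: "p \<in> cbox 0 M"
    \<comment> \<open>The lower boundary term vanishes because of the factor \<open>q\<close>, the
      upper one because \<open>\<psi> (p, M) = 0\<close>.\<close>
    have "((\<lambda>q. b (p, q)) has_integral M * F1 (p * M) * \<psi> (p, M) - 0 * F1 (p * 0) * \<psi> (p, 0)) {0..M}"
      unfolding b_def using M(1)
      by (intro fundamental_theorem_of_calculus)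
        (auto simp: has_real_derivative_iff_has_vector_derivative[symmetric] algebra_simps
          intro!: derivative_eq_intros DERIV_chain'[OF _ F(2)] DERIV_subset[OF \<psi>(1)])
    then show "integral (cbox 0 M) (\<lambda>q. b (p, q)) = 0"
      using p M(2)[of p] by (simp add: integral_unique)
  qed
  finally show ?thesis by simp
qed

text \<open>The set where \<open>p * q\<close> is nonnegative consists of the first and third
  quadrants. The point reflection carries the third to the first and preserves both
  \<open>p * q\<close> and the form of the integrand, so each contributes the same amount.\<close>

lemma double_cone_integral:
  fixes F F1 F2 :: "real \<Rightarrow> real" and \<psi> \<psi>q \<psi>pq :: "real \<times> real \<Rightarrow> real"
  assumes F: "\<And>s. (F has_real_derivative F1 s) (at s)" "\<And>s. (F1 has_real_derivative F2 s) (at s)"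
    and ode: "\<And>s. s * F2 s + F1 s = k * F s"
    and F2: "continuous_on UNIV F2"
    and \<psi>: "\<And>p q. ((\<lambda>q. \<psi> (p, q)) has_real_derivative \<psi>q (p, q)) (at q)"
      "\<And>p q. ((\<lambda>p. \<psi>q (p, q)) has_real_derivative \<psi>pq (p, q)) (at p)"
    and cont: "continuous_on UNIV \<psi>" "continuous_on UNIV \<psi>q" "continuous_on UNIV \<psi>pq"
    and M: "M > 0" "\<And>p q. \<bar>p\<bar> \<ge> M \<or> \<bar>q\<bar> \<ge> M \<Longrightarrow> \<psi> (p, q) = 0 \<and> \<psi>q (p, q) = 0 \<and> \<psi>pq (p, q) = 0"
  shows "(LINT x|lborel. indicator {(p, q). p * q \<ge> 0} x * (case x of (p, q) \<Rightarrow> F (p * q) * (\<psi>pq (p, q) - k * \<psi> (p, q))))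
    = 2 * F 0 * \<psi> (0, 0)"
proof -
  define c where "c = (\<lambda>(p, q). F (p * q) * (\<psi>pq (p, q) - k * \<psi> (p, q)))"
  let ?Q1 = "cbox (0, 0) (M, M)" and ?Q3 = "cbox (- M, - M) (0, 0)"
  have cF: "continuous_on UNIV F"
    using F by (meson DERIV_isCont continuous_at_imp_continuous_on)
  note [continuous_intros] = continuous_on_compose2[OF cF] continuous_on_compose2[OF cont(1)]
    continuous_on_compose2[OF cont(2)] continuous_on_compose2[OF cont(3)]
  have cc: "continuous_on S c" for S
    unfolding c_def split_beta by (intro continuous_intros; auto)
  have c0: "c (p, q) = 0" if "\<bar>p\<bar> \<ge> M \<or> \<bar>q\<bar> \<ge> M" for p q
    using M(2)[OF that] by (simp add: c_def)
  have int: "set_integrable lborel (cbox a b) c" for a b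
    unfolding set_integrable_def by (intro borel_integrable_compact cc compact_cbox)
  have box: "(LINT x|lborel. indicator (cbox a b) x * c x) = integral (cbox a b) c" for a b
    using set_borel_integral_eq_integral(2)[OF int, of a b] by (simp add: set_lebesgue_integral_def)
  \<comment> \<open>The two closed squares overlap only at the origin, where the sum of their
    indicators counts twice; that point is a null set.\<close>
  have "AE x in lborel. x \<noteq> (0 :: real \<times> real)" by (rule AE_lborel_singleton)
  then have "AE x in lborel. indicator {(p, q). p * q \<ge> 0} x * c x
      = indicator ?Q1 x * c x + indicator ?Q3 x * c x"
  proof eventually_elim
    fix x :: "real \<times> real" assume x: "x \<noteq> 0"
    obtain p q where [simp]: "x = (p, q)" by (cases x)
    have "c (p, q) = 0 \<or> (\<bar>p\<bar> < M \<and> \<bar>q\<bar> < M)"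
      using c0 by force
    then show "indicator {(p, q). p * q \<ge> 0} x * c x = indicator ?Q1 x * c x + indicator ?Q3 x * c x"
      using x by (auto simp: indicator_def cbox_Pair_eq zero_prod_def zero_le_mult_iff mult_le_0_iff)
  qed
  then have "(LINT x|lborel. indicator {(p, q). p * q \<ge> 0} x * c x)
      = (LINT x|lborel. indicator ?Q1 x * c x + indicator ?Q3 x * c x)"
  proof (rule integral_cong_AE[rotated 2])
    have [measurable]: "c \<in> borel_measurable borel"
      by (intro borel_measurable_continuous_onI cc)
    have [measurable]: "{(p, q). p * q \<ge> (0::real)} \<in> sets borel"
      unfolding case_prod_beta by (intro borel_closed closed_Collect_le continuous_intros)
    show "(\<lambda>x. indicator {(p, q). p * q \<ge> 0} x * c x) \<in> borel_measurable lborel" by measurable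
    show "(\<lambda>x. indicator ?Q1 x * c x + indicator ?Q3 x * c x) \<in> borel_measurable lborel" by measurable
  qed
  also have "\<dots> = (LINT x|lborel. indicator ?Q1 x * c x) + (LINT x|lborel. indicator ?Q3 x * c x)"
    using int by (intro Bochner_Integration.integral_add) (simp_all add: set_integrable_def)
  also have "(LINT x|lborel. indicator ?Q1 x * c x) = F 0 * \<psi> (0, 0)"
    unfolding box unfolding c_def
    by (rule quadrant_integral[OF F ode F2 \<psi> cont]) (use M in auto)
  also have "(LINT x|lborel. indicator ?Q3 x * c x) = integral ?Q1 (\<lambda>x. c (- x))"
    unfolding box using Henstock_Kurzweil_Integration.integral_reflect[of "(M, M)" "(0, 0)" "\<lambda>x. c (- x)"]
    by (simp add: zero_prod_def)
  also have "\<dots> = integral ?Q1 (\<lambda>(p, q). F (p * q) * (\<psi>pq (- p, - q) - k * \<psi> (- p, - q)))"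
    by (intro Henstock_Kurzweil_Integration.integral_cong) (auto simp: c_def)
  also have "\<dots> = F 0 * \<psi> (- 0, - 0)"
  proof -
    \<comment> \<open>Under reflection the first derivative changes sign, but the mixed second
      derivative does not, so the reflected functions again satisfy the hypotheses of
      \<open>quadrant_integral\<close>.\<close>
    have *: "((\<lambda>q. \<psi> (- p, - q)) has_real_derivative - \<psi>q (- p, - q)) (at q)" for p q
      using DERIV_chain2[OF \<psi>(1)[of "- p" "- q"] DERIV_minus[OF DERIV_ident]] by simp
    have **: "((\<lambda>p. - \<psi>q (- p, - q)) has_real_derivative \<psi>pq (- p, - q)) (at p)" for p q
      using DERIV_minus[OF DERIV_chain2[OF \<psi>(2)[of "- q" "- p"] DERIV_minus[OF DERIV_ident]]] by simp
    show ?thesis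
      using quadrant_integral[OF F ode F2, of "\<lambda>(p, q). \<psi> (- p, - q)" "\<lambda>(p, q). - \<psi>q (- p, - q)"
          "\<lambda>(p, q). \<psi>pq (- p, - q)" M] * ** M
      by (simp add: split_beta continuous_intros)
  qed
  finally show ?thesis by (simp add: c_def)
qed

subsection \<open>Regular distributions\<close>

text \<open>Boundedness gives the real \<open>SUP\<close> in the seminorms its meaning as a least
  upper bound.\<close>

lemma test_function_bdd:
  assumes "\<phi> \<in> test_functions"
  shows "bdd_above (range (\<lambda>x. \<bar>\<phi> x\<bar>))"
proof -
  have "compact (\<phi> ` supp \<phi>)"
    using assms unfolding test_functions_def
    by (auto intro!: compact_continuous_image intro: continuous_on_subset[OF smooth_imp_continuous])
  then obtain B where B: "\<And>x. x \<in> supp \<phi> \<Longrightarrow> \<bar>\<phi> x\<bar> \<le> B"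
    using compact_imp_bounded bounded_iff by (metis imageI real_norm_def)
  have "\<bar>\<phi> x\<bar> \<le> max B 0" for x
    using B[of x] eq_0_outside_supp[of x \<phi>] by fastforce
  then show ?thesis by (intro bdd_aboveI2)
qed

lemma test_function_abs_le_SUP: "\<phi> \<in> test_functions \<Longrightarrow> \<bar>\<phi> x\<bar> \<le> (SUP x. \<bar>\<phi> x\<bar>)"
  by (intro cSUP_upper test_function_bdd) auto

lemma test_function_borel: "\<phi> \<in> test_functions \<Longrightarrow> \<phi> \<in> borel_measurable borel"
  by (auto simp: test_functions_def intro: borel_measurable_continuous_onI smooth_imp_continuous)

text \<open>The product is dominated by the supremum of \<open>\<bar>\<phi>\<bar>\<close> times the
  restriction of \<open>g\<close> to the compact support of \<open>\<phi>\<close>.\<close>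

lemma integrable_mult_test_function:
  assumes "locally_integrable g" "\<phi> \<in> test_functions"
  shows "integrable lebesgue (\<lambda>x. g x * \<phi> x)"
proof (rule Bochner_Integration.integrable_bound)
  let ?G = "\<lambda>x. indicator (supp \<phi>) x * g x"
  have G: "integrable lebesgue ?G"
    using assms by (simp add: locally_integrable_def test_functions_def set_integrable_def)
  then show "integrable lebesgue (\<lambda>x. (SUP x. \<bar>\<phi> x\<bar>) * ?G x)" by simp
  have eq: "g x * \<phi> x = ?G x * \<phi> x" for x
    using eq_0_outside_supp[of x \<phi>] by (auto simp: indicator_def)
  have "\<phi> \<in> borel_measurable lebesgue"
    using test_function_borel[OF assms(2)] by (simp add: measurable_completion)
  with G show "(\<lambda>x. g x * \<phi> x) \<in> borel_measurable lebesgue"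
    unfolding eq by (intro borel_measurable_times[of ?G]) auto
  have S: "\<bar>\<phi> x\<bar> \<le> (SUP x. \<bar>\<phi> x\<bar>)" for x
    using assms(2) by (rule test_function_abs_le_SUP)
  have "norm (g x * \<phi> x) \<le> norm ((SUP x. \<bar>\<phi> x\<bar>) * ?G x)" for x
  proof -
    have "norm (g x * \<phi> x) = \<bar>\<phi> x\<bar> * \<bar>?G x\<bar>"
      unfolding eq by (simp add: abs_mult)
    also have "\<dots> \<le> (SUP x. \<bar>\<phi> x\<bar>) * \<bar>?G x\<bar>" by (intro mult_right_mono S) simp
    also have "\<dots> \<le> norm ((SUP x. \<bar>\<phi> x\<bar>) * ?G x)"
      unfolding real_norm_def abs_mult by (intro mult_right_mono) auto
    finally show ?thesis .
  qed
  then show "AE x in lebesgue. norm (g x * \<phi> x) \<le> norm ((SUP x. \<bar>\<phi> x\<bar>) * ?G x)" by simp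
qed

text \<open>Such a functional has order zero: on \<open>K\<close> the constant is the integral of
  \<open>\<bar>g\<bar>\<close> over \<open>K\<close>, and no derivatives are required.\<close>

lemma distribution_regular_distr:
  fixes g :: "'a::euclidean_space \<Rightarrow> real"
  assumes "locally_integrable g"
  shows "distribution (regular_distr g)"
  unfolding distribution_def
proof (intro conjI ballI allI impI)
  fix \<phi> :: "'a \<Rightarrow> real" and c assume \<phi>: "\<phi> \<in> test_functions"
  show "regular_distr g (\<lambda>x. c * \<phi> x) = c * regular_distr g \<phi>"
    by (simp add: regular_distr_def mult.left_commute)
  fix \<psi> :: "'a \<Rightarrow> real" assume "\<psi> \<in> test_functions"
  with \<phi> show "regular_distr g (\<lambda>x. \<phi> x + \<psi> x) = regular_distr g \<phi> + regular_distr g \<psi>"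
    by (simp add: regular_distr_def distrib_left integrable_mult_test_function assms)
next
  fix K :: "'a set" assume "compact K"
  then have K: "integrable lebesgue (\<lambda>x. indicator K x * g x)"
    using assms by (simp add: locally_integrable_def set_integrable_def)
  let ?C = "LINT x|lebesgue. \<bar>indicator K x * g x\<bar>"
  have "\<bar>regular_distr g \<phi>\<bar> \<le> ?C * (SUP x. \<bar>\<phi> x\<bar>)"
    if \<phi>: "\<phi> \<in> test_functions" "supp \<phi> \<subseteq> K" for \<phi> :: "'a \<Rightarrow> real"
  proof -
    have "\<bar>regular_distr g \<phi>\<bar> \<le> (LINT x|lebesgue. \<bar>g x * \<phi> x\<bar>)"
      unfolding regular_distr_def by (rule integral_abs_bound)
    also have "\<dots> \<le> (LINT x|lebesgue. \<bar>indicator K x * g x\<bar> * (SUP x. \<bar>\<phi> x\<bar>))"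
    proof (rule integral_mono)
      show "integrable lebesgue (\<lambda>x. \<bar>g x * \<phi> x\<bar>)"
        by (intro integrable_abs integrable_mult_test_function assms \<phi>)
      show "integrable lebesgue (\<lambda>x. \<bar>indicator K x * g x\<bar> * (SUP x. \<bar>\<phi> x\<bar>))"
        using K by (intro integrable_mult_left integrable_abs)
      fix x
      have "\<bar>g x * \<phi> x\<bar> = \<bar>indicator K x * g x\<bar> * \<bar>\<phi> x\<bar>"
        using eq_0_outside_supp[of x \<phi>] \<phi>(2) by (auto simp: indicator_def abs_mult)
      also have "\<dots> \<le> \<bar>indicator K x * g x\<bar> * (SUP x. \<bar>\<phi> x\<bar>)"
        by (intro mult_left_mono test_function_abs_le_SUP \<phi>) simp
      finally show "\<bar>g x * \<phi> x\<bar> \<le> \<bar>indicator K x * g x\<bar> * (SUP x. \<bar>\<phi> x\<bar>)" .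
    qed
    finally show ?thesis by simp
  qed
  \<comment> \<open>With \<open>N = 0\<close> only the empty list remains, so the sum of seminorms
    reduces to the supremum norm.\<close>
  moreover have "{vs. set vs \<subseteq> Basis \<and> length vs \<le> 0} = {[] :: 'a list}" by auto
  ultimately show "\<exists>C N. \<forall>\<phi>\<in>test_functions. supp \<phi> \<subseteq> K \<longrightarrow>
       \<bar>regular_distr g \<phi>\<bar> \<le> C * (\<Sum>vs | set vs \<subseteq> Basis \<and> length vs \<le> N. SUP x. \<bar>foldr dir_deriv vs \<phi> x\<bar>)"
    by (intro exI[of _ ?C] exI[of _ 0]) simp
qed

text \<open>On a compact \<open>K\<close> the function lives on the compact set
  \<open>K \<inter> S\<close>, where \<open>c\<close> is integrable for \<open>lborel\<close>;
  integrability then passes to the completion.\<close>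

lemma locally_integrable_indicator_continuous:
  fixes c :: "'a::euclidean_space \<Rightarrow> real"
  assumes "closed S" "continuous_on UNIV c"
  shows "locally_integrable (\<lambda>x. indicator S x * c x)"
  unfolding locally_integrable_def
proof (intro allI impI)
  fix K :: "'a set" assume "compact K"
  then have "integrable lborel (\<lambda>x. indicator (K \<inter> S) x *\<^sub>R c x)"
    using assms by (intro borel_integrable_compact compact_Int_closed) (auto intro: continuous_on_subset)
  then have "integrable lebesgue (\<lambda>x. indicator (K \<inter> S) x *\<^sub>R c x)"
    by (simp add: integrable_completion borel_measurable_integrable)
  then show "(\<lambda>x. indicator S x * c x) absolutely_integrable_on K"
    by (simp add: set_integrable_def indicator_inter_arith mult.assoc)
qed

subsection \<open>The fundamental solution\<close>

text \<open>This is \<open>chi\<close> for \<open>A = 1 / 4\<close>, arranged as an indicator times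
  a continuous function so that the preceding lemma applies.\<close>

definition cone_kernel :: "real \<times> real \<Rightarrow> real"
  where "cone_kernel x = indicator {(R, u). R\<^sup>2 - u\<^sup>2 \<ge> 0} x *
    (case x of (R, u) \<Rightarrow> exp (R / 2) * bessel (1 / 4) (R\<^sup>2 - u\<^sup>2))"

lemma closed_cone: "closed {(R, u). R\<^sup>2 - u\<^sup>2 \<ge> (0::real)}"
  unfolding case_prod_beta by (intro closed_Collect_le continuous_intros)

lemma continuous_cone_density: "continuous_on UNIV (\<lambda>(R, u). exp (R / 2) * bessel (1 / 4) (R\<^sup>2 - u\<^sup>2))"
  unfolding split_beta by (intro continuous_intros continuous_on_compose2[OF continuous_bessel[of UNIV]]) auto

lemma locally_integrable_cone_kernel: "locally_integrable cone_kernel"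
  unfolding cone_kernel_def[abs_def]
  by (rule locally_integrable_indicator_continuous[OF closed_cone continuous_cone_density])

lemma cone_kernel_borel: "cone_kernel \<in> borel_measurable borel"
  unfolding cone_kernel_def[abs_def]
  using closed_cone continuous_cone_density
  by (intro borel_measurable_times borel_measurable_indicator borel_measurable_continuous_onI borel_closed)

text \<open>In the second-order terms the two signs from moving derivatives cancel, whereas the
  first-order term changes sign. Integrability of each product allows the three integrals to be
  merged.\<close>

lemma entropy_op_regular_distr:
  assumes "locally_integrable g" "\<phi> \<in> test_functions"
  shows "entropy_op (regular_distr g) \<phi> = (LINT x|lebesgue. g x *
    (dir_deriv (1, 0) (dir_deriv (1, 0) \<phi>) x - dir_deriv (0, 1) (dir_deriv (0, 1) \<phi>) x + dir_deriv (1, 0) \<phi> x))"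
  using assms
  by (simp add: entropy_op_def distr_deriv_def regular_distr_def algebra_simps
      integrable_mult_test_function test_function_dir_deriv)

lemma entropy_op_cone_kernel:
  assumes \<phi>: "\<phi> \<in> test_functions"
  shows "entropy_op (regular_distr cone_kernel) \<phi> = 4 * \<phi> (0, 0)"
proof -
  let ?d = dir_deriv
  let ?R = "(1, 0) :: real \<times> real" and ?u = "(0, 1) :: real \<times> real"
  \<comment> \<open>These are the directions of the \<open>p\<close>- and
    \<open>q\<close>-derivatives in the \<open>(R, u)\<close> plane, that is, the partial
    derivatives of \<open>\<gamma>\<close>.\<close>
  let ?a = "(1 / 2, 1 / 2) :: real \<times> real" and ?b = "(1 / 2, - 1 / 2) :: real \<times> real"
  define \<gamma> where "\<gamma> = (\<lambda>(p, q). ((p + q) / 2, (p - q) / 2) :: real \<times> real)"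
  \<comment> \<open>The factor \<open>exp (R / 2)\<close> at \<open>R = (p + q) / 2\<close>; each
    differentiation of it in \<open>p\<close> or \<open>q\<close> contributes
    \<open>1 / 4\<close>.\<close>
  define E where "E = (\<lambda>(p, q). exp ((p + q) / 4) :: real)"
  define L where "L = (\<lambda>x. ?d ?R (?d ?R \<phi>) x - ?d ?u (?d ?u \<phi>) x + ?d ?R \<phi> x)"
  have sm: "smooth \<phi>" "\<And>v. smooth (?d v \<phi>)" "\<And>v w. smooth (?d w (?d v \<phi>))"
    using \<phi> smooth_dir_deriv by (auto simp: test_functions_def)
  define \<psi> where "\<psi> x = E x * \<phi> (\<gamma> x)" for x
  define \<psi>q where "\<psi>q x = E x * (\<phi> (\<gamma> x) / 4 + ?d ?b \<phi> (\<gamma> x))" for x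
  define \<psi>pq where "\<psi>pq x = E x * (\<phi> (\<gamma> x) / 16 + ?d ?b \<phi> (\<gamma> x) / 4 + ?d ?a \<phi> (\<gamma> x) / 4 + ?d ?a (?d ?b \<phi>) (\<gamma> x))" for x
  have cont\<gamma>: "continuous_on UNIV \<gamma>" and contE: "continuous_on UNIV E"
    unfolding \<gamma>_def E_def split_beta by (intro continuous_intros; simp)+
  note [continuous_intros] = contE
    continuous_on_compose2[OF smooth_imp_continuous[OF sm(1)] cont\<gamma>]
    continuous_on_compose2[OF smooth_imp_continuous[OF sm(2)] cont\<gamma>]
    continuous_on_compose2[OF smooth_imp_continuous[OF sm(3)] cont\<gamma>]
  have cont: "continuous_on UNIV \<psi>" "continuous_on UNIV \<psi>q" "continuous_on UNIV \<psi>pq"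
    unfolding \<psi>_def \<psi>q_def \<psi>pq_def by (intro continuous_intros; simp)+
  have \<gamma>q: "((\<lambda>q. \<gamma> (p, q)) has_vector_derivative ?b) (at q)"
    and \<gamma>p: "((\<lambda>p. \<gamma> (p, q)) has_vector_derivative ?a) (at p)" for p q
    unfolding \<gamma>_def has_vector_derivative_def by (auto intro!: derivative_eq_intros simp: field_simps)
  have Eq: "((\<lambda>q. E (p, q)) has_real_derivative E (p, q) / 4) (at q)"
    and Ep: "((\<lambda>p. E (p, q)) has_real_derivative E (p, q) / 4) (at p)" for p q
    unfolding E_def by (auto intro!: derivative_eq_intros)
  have D\<psi>: "((\<lambda>q. \<psi> (p, q)) has_real_derivative \<psi>q (p, q)) (at q)" for p q
    unfolding \<psi>_def \<psi>q_def
    by (auto intro!: derivative_eq_intros Eq smooth_has_real_derivative[OF sm(1) \<gamma>q] simp: algebra_simps)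
  have D\<psi>q: "((\<lambda>p. \<psi>q (p, q)) has_real_derivative \<psi>pq (p, q)) (at p)" for p q
    unfolding \<psi>q_def \<psi>pq_def
    by (auto intro!: derivative_eq_intros Ep smooth_has_real_derivative[OF sm(1) \<gamma>p]
        smooth_has_real_derivative[OF sm(2) \<gamma>p] simp: algebra_simps)
  obtain B where B: "\<And>x. x \<in> supp \<phi> \<Longrightarrow> norm x \<le> B" "B > 0"
    using \<phi> compact_imp_bounded[of "supp \<phi>"] unfolding test_functions_def bounded_pos by blast
  \<comment> \<open>From \<open>p = R + u\<close> and \<open>q = R - u\<close>, both are at most
    twice the norm of \<open>(R, u)\<close> in absolute value; so \<open>M\<close> forces the norm
    above \<open>B\<close>, outside the support.\<close>
  define M where "M = 2 * B + 1"
  have zero: "\<psi> (p, q) = 0 \<and> \<psi>q (p, q) = 0 \<and> \<psi>pq (p, q) = 0" if "\<bar>p\<bar> \<ge> M \<or> \<bar>q\<bar> \<ge> M" for p q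
  proof -
    let ?x = "\<gamma> (p, q)"
    have "\<bar>fst ?x\<bar> \<le> norm ?x" "\<bar>snd ?x\<bar> \<le> norm ?x"
      using norm_fst_le[of "fst ?x" "snd ?x"] norm_snd_le[of "snd ?x" "fst ?x"] by simp_all
    then have "norm ?x > B"
      using that by (auto simp: M_def \<gamma>_def)
    then have x: "?x \<notin> supp \<phi>" using B(1)[of ?x] by (meson not_less)
    then have "?x \<notin> supp (?d v \<phi>)" for v
      using supp_dir_deriv by blast
    with x show ?thesis
      by (simp add: \<psi>_def \<psi>q_def \<psi>pq_def eq_0_outside_supp dir_deriv_eq_0_outside_supp)
  qed
  \<comment> \<open>The terms with \<open>\<phi> / 16\<close> cancel. The first-order terms combine
    to the \<open>R\<close>-derivative because \<open>?a + ?b = ?R\<close>, and four times the mixed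
    derivative is the wave operator by \<open>ab\<close>.\<close>
  have key: "E x * L (\<gamma> x) = 4 * (\<psi>pq x - (1 / 4)\<^sup>2 * \<psi> x)" for x
  proof -
    have a: "?d ?a f y = 1 / 2 * ?d ?R f y + 1 / 2 * ?d ?u f y"
      and b: "?d ?b f y = 1 / 2 * ?d ?R f y - 1 / 2 * ?d ?u f y"
      if "smooth f" for f :: "real \<times> real \<Rightarrow> real" and y
      using fun_cong[OF smooth_dir_deriv_lin[OF that, of "1 / 2" ?R "1 / 2" ?u], of y]
        fun_cong[OF smooth_dir_deriv_lin[OF that, of "1 / 2" ?R "- 1 / 2" ?u], of y] by simp_all
    have ab: "?d ?a (?d ?b \<phi>) y = 1 / 4 * (?d ?R (?d ?R \<phi>) y - ?d ?u (?d ?u \<phi>) y)" for y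
    proof -
      have "?d ?a (?d ?b \<phi>) y = 1 / 2 * ?d ?R (?d ?b \<phi>) y + 1 / 2 * ?d ?u (?d ?b \<phi>) y"
        by (rule a[OF sm(2)])
      also have "?d ?R (?d ?b \<phi>) y = ?d ?b (?d ?R \<phi>) y"
        by (rule dir_deriv_commute[OF sm(1)])
      also have "\<dots> = 1 / 2 * ?d ?R (?d ?R \<phi>) y - 1 / 2 * ?d ?u (?d ?R \<phi>) y"
        by (rule b[OF sm(2)])
      also have "?d ?u (?d ?b \<phi>) y = ?d ?b (?d ?u \<phi>) y"
        by (rule dir_deriv_commute[OF sm(1)])
      also have "\<dots> = 1 / 2 * ?d ?R (?d ?u \<phi>) y - 1 / 2 * ?d ?u (?d ?u \<phi>) y"
        by (rule b[OF sm(2)])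
      also have "?d ?R (?d ?u \<phi>) y = ?d ?u (?d ?R \<phi>) y"
        by (rule dir_deriv_commute[OF sm(1)])
      finally show ?thesis by (simp add: field_simps)
    qed
    show ?thesis
      unfolding L_def \<psi>_def \<psi>pq_def ab a[OF sm(1), of "\<gamma> x"] b[OF sm(1), of "\<gamma> x"]
      by (simp add: power2_eq_square field_simps)
  qed
  obtain F1 F2 where F: "\<And>s. (bessel (1 / 4) has_real_derivative F1 s) (at s)"
    "\<And>s. (F1 has_real_derivative F2 s) (at s)"
    "\<And>s. s * F2 s + F1 s = (1 / 4)\<^sup>2 * bessel (1 / 4) s" "continuous_on UNIV F2"
    using bessel_ode by metis
  have kern: "cone_kernel (\<gamma> x) * L (\<gamma> x) = 4 * (indicator {(p, q). p * q \<ge> 0} x * (case x of (p, q) \<Rightarrow>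
      bessel (1 / 4) (p * q) * (\<psi>pq (p, q) - (1 / 4)\<^sup>2 * \<psi> (p, q))))" for x
  proof -
    obtain p q where x: "x = (p, q)" by (cases x)
    \<comment> \<open>This identity turns both the cone condition and the argument of
      \<open>bessel\<close> into expressions in \<open>p * q\<close>.\<close>
    have "((p + q) / 2)\<^sup>2 - ((p - q) / 2)\<^sup>2 = p * q"
      by (simp add: power2_eq_square field_simps)
    then have "cone_kernel (\<gamma> x) = indicator {(p, q). p * q \<ge> 0} x * (E x * bessel (1 / 4) (p * q))"
      by (simp add: x cone_kernel_def \<gamma>_def E_def indicator_def)
    then have "cone_kernel (\<gamma> x) * L (\<gamma> x) = indicator {(p, q). p * q \<ge> 0} x * (bessel (1 / 4) (p * q) * (E x * L (\<gamma> x)))"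
      by simp
    then show ?thesis by (simp add: key x)
  qed
  have Lb: "L \<in> borel_measurable borel"
    unfolding L_def using \<phi> test_function_borel test_function_dir_deriv
    by (intro borel_measurable_add borel_measurable_diff) blast+
  have "entropy_op (regular_distr cone_kernel) \<phi> = (LINT x|lebesgue. cone_kernel x * L x)"
    unfolding L_def by (rule entropy_op_regular_distr[OF locally_integrable_cone_kernel \<phi>])
  also have "\<dots> = (LINT x|lborel. cone_kernel x * L x)"
    using cone_kernel_borel Lb by (intro integral_completion) simp
  also have "\<dots> = (LINT x|lborel. cone_kernel (\<gamma> x) * L (\<gamma> x)) / 2"
    using integral_lightcone[of "\<lambda>x. cone_kernel x * L x"] cone_kernel_borel Lb
    by (simp add: \<gamma>_def split_beta)
  \<comment> \<open>The outer \<open>2\<close> is the \<open>4\<close> from \<open>key\<close>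
    halved by the Jacobian; the inner \<open>2\<close> counts the quadrants.\<close>
  also have "\<dots> = 2 * (2 * bessel (1 / 4) 0 * \<psi> (0, 0))"
    unfolding kern
    using double_cone_integral[OF F D\<psi> D\<psi>q cont, of M] zero B(2)
    by (simp add: M_def)
  finally show ?thesis
    by (simp add: bessel_0 \<psi>_def E_def \<gamma>_def)
qed

text \<open>The Lebesgue integral is total, with a default value off the integrable functions. The
  claims of local integrability and of the distribution property ensure that
  \<open>regular_distr chi\<close> is a genuine element of the distribution space.\<close>

theorem theorem4p2:
  fixes A :: real and f :: "real \<Rightarrow> real" and chi :: "real \<times> real \<Rightarrow> real"
  assumes A_def: "A = 1 / 4"
    and f_def: "\<And>m. f m = (\<Sum>n. (A ^ n / fact n)\<^sup>2 * (- 1) ^ n * m ^ n)"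
    and chi_def: "\<And>R u. chi (R, u) =
          exp (R / 2) * indicator {(R, u). R\<^sup>2 - u\<^sup>2 \<ge> 0} (R, u) * f (u\<^sup>2 - R\<^sup>2)"
  shows "(\<forall>R u. chi (R, u) = exp (R / 2) * indicator {(R, u). R\<^sup>2 - u\<^sup>2 \<ge> 0} (R, u) *
            (\<Sum>n. (A ^ n / fact n)\<^sup>2 * (R\<^sup>2 - u\<^sup>2) ^ n))
       \<and> locally_integrable chi \<and> distribution (regular_distr chi)
       \<and> distr_eq (entropy_op (regular_distr chi)) (\<lambda>\<phi>. 4 * dirac (0, 0) \<phi>)"
proof -
  \<comment> \<open>The alternating sign moves into the argument, so evaluation at
    \<open>u\<^sup>2 - R\<^sup>2\<close> gives a series in
    \<open>R\<^sup>2 - u\<^sup>2\<close>.\<close>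
  have "f m = bessel A (- m)" for m
    unfolding f_def bessel_def by (simp add: mult.assoc flip: power_mult_distrib)
  then have chi: "chi (R, u) = exp (R / 2) * indicator {(R, u). R\<^sup>2 - u\<^sup>2 \<ge> 0} (R, u) * bessel A (R\<^sup>2 - u\<^sup>2)" for R u
    by (simp add: chi_def)
  then have "chi = cone_kernel"
    by (auto simp: cone_kernel_def A_def)
  with chi show ?thesis
    using locally_integrable_cone_kernel entropy_op_cone_kernel
    by (simp add: distribution_regular_distr distr_eq_def dirac_def bessel_def)
qed

end
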